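(* Let $\mathcal G=(m,A,\boldsymbol r,\boldsymbol\tau,u)$ be a stateless mean field game with power law discounting $u(r,t)=rt^{-\alpha}$, $\alpha\in[0,1]$, whose sojourn-time function $\boldsymbol\tau$ is continuous and rate monotonous. Then $\mathcal G$ has a stationary equilibrium. A mass distribution $\boldsymbol\mu^\dagger\in\mathcal U_m(A)$ is a stationary equilibrium if and only if $$\frac{r_i}{\tau_i(\boldsymbol\mu^\dagger)}\ \ge\ \frac{r_j}{\tau_j(\boldsymbol\mu^\dagger)}\qquad\text{for all } i\in A^\dagger,\ j\in A,$$ where $A^\dagger=\{i\in A\mid\mu_i^\dagger>0\}$.
   Context: Game data: a total mass $m>0$ of nonatomic agents; a finite action set $A=\{1,\dots,n\}$, $n\ge2$; rewards $\boldsymbol r=(r_i)_{i\in A}$, $r_i>0$; for $s>0$ put $\mathcal U_s(A)=\{\boldsymbol\mu\in\mathbb R_{\ge0}^n\mid\sum_{i\in A}\mu_i=s\}$; sojourn-time functions $\tau_i:\bigcup_{s>0}\mathcal U_s(A)\to(0,\infty)$, $\boldsymbol\tau=(\tau_i)_{i\in A}$; a utility function $u(r,t)$ (present value of reward $r$ received at time $t$). The action rates are $x_i(\boldsymbol\mu)=\mu_i/\tau_i(\boldsymbol\mu)$. Continuous and rate monotonous: $\boldsymbol\tau$ is continuous on each $\mathcal U_s(A)$, and for all $\boldsymbol\mu,\boldsymbol\mu'\in\bigcup_{s>0}\mathcal U_s(A)$ and all $i\in A$, $x_i(\boldsymbol\mu)<x_i(\boldsymbol\mu')$ implies $\tau_i(\boldsymbol\mu)\le\tau_i(\boldsymbol\mu')$.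 Strategies: $\mathcal P(A)$ is the set of probability vectors on $A$. A strategy is a sequence $\boldsymbol\sigma=(\sigma_k)_{k\ge1}\in\mathcal P(A)^{\mathbb N}$; the $k$th action $a_k$ is drawn from $\sigma_k$, independently over $k$. It is stationary if $\sigma_k$ does not depend on $k$ (then identified with an element of $\mathcal P(A)$). Optimality for $0\le\alpha\le1$: given sojourn times $\boldsymbol\tau=(\tau_i)_{i\in A}$, put $\theta_k=\sum_{j=1}^k\tau_{a_j}$. As the total utility diverges, strategies are compared through the leading-order growth of the total utility generated by time $T$, $V_T(\boldsymbol\sigma,\boldsymbol\tau)=\mathbb E_{\boldsymbol\sigma}\big[\sum_{k:\theta_k\le T}r_{a_k}\theta_k^{-\alpha}\big]$: $\boldsymbol\sigma^*$ is optimal if for every strategy $\boldsymbol\sigma$, $\limsup_{T\to\infty}\big(V_T(\boldsymbol\sigma,\boldsymbol\tau)-V_T(\boldsymbol\sigma^*,\boldsymbol\tau)\big)/g(T)\le0$, where $g(T)=T^{1-\alpha}$ if $\alpha<1$ and $g(T)=\log T$ if $\alpha=1$. Stationary equilibrium: a mass distribution $\boldsymbol\mu^\dagger\in\mathcal U_m(A)$ for which there is $\sigma^\dagger\in\mathcal P(A)$ such that (a) $\mu_i^\dagger=\theta\,\sigma^\dagger(i)\,\tau_i(\boldsymbol\mu^\dagger)$ for all $i\in A$, for some normalizing constant $\theta$, and (b) the stationary strategy $\sigma^\dagger$ is optimal among all strategies for the sojourn times $\boldsymbol\tau(\boldsymbol\mu^\dagger)$. *)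

theory Defs
  imports "HOL-Probability.Probability"
begin

text \<open>
  The action set is the finite type \<open>'a\<close>. Rewards, sojourn times and mass distributions
  are vectors in \<open>real ^ 'a\<close>; probability vectors on the actions are elements of \<open>'a pmf\<close>.
\<close>

definition mass_simplex :: "real \<Rightarrow> (real ^ 'a::finite) set" where
  "mass_simplex s = {\<mu>. (\<forall>i. 0 \<le> \<mu> $ i) \<and> (\<Sum>i\<in>UNIV. \<mu> $ i) = s}"

definition mass_distributions :: "(real ^ 'a::finite) set" where
  "mass_distributions = (\<Union>s\<in>{0<..}. mass_simplex s)"

definition action_rate :: "(real ^ 'a \<Rightarrow> real ^ 'a) \<Rightarrow> real ^ 'a \<Rightarrow> 'a::finite \<Rightarrow> real" where
  "action_rate \<tau> \<mu> i = \<mu> $ i / \<tau> \<mu> $ i"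

definition rate_monotonous :: "(real ^ 'a::finite \<Rightarrow> real ^ 'a) \<Rightarrow> bool" where
  "rate_monotonous \<tau> \<longleftrightarrow>
     (\<forall>\<mu>\<in>mass_distributions. \<forall>\<mu>'\<in>mass_distributions. \<forall>i.
        action_rate \<tau> \<mu> i < action_rate \<tau> \<mu>' i \<longrightarrow> \<tau> \<mu> $ i \<le> \<tau> \<mu>' $ i)"

text \<open>
  Sequences are indexed from 0: for a strategy \<open>\<sigma>\<close>, \<open>\<sigma> k\<close> is the distribution of the
  (\<open>k\<close>+1)-st action, and \<open>completion_time t a k\<close> is the time at which the (\<open>k\<close>+1)-st
  action ends, so it includes the sojourn time of that action.
\<close>

type_synonym 'a strategy = "nat \<Rightarrow> 'a pmf"

definition action_measure :: "'a strategy \<Rightarrow> (nat \<Rightarrow> 'a) measure" where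
  "action_measure \<sigma> = (\<Pi>\<^sub>M k\<in>UNIV. measure_pmf (\<sigma> k))"

definition completion_time :: "real ^ 'a::finite \<Rightarrow> (nat \<Rightarrow> 'a) \<Rightarrow> nat \<Rightarrow> real" where
  "completion_time t a k = (\<Sum>j\<le>k. t $ a j)"

definition expected_utility ::
  "(real \<Rightarrow> real \<Rightarrow> real) \<Rightarrow> real ^ 'a::finite \<Rightarrow> real ^ 'a \<Rightarrow> 'a strategy \<Rightarrow> real \<Rightarrow> real" where
  "expected_utility u r t \<sigma> T =
     (\<integral>a. (\<Sum>k\<in>{k. completion_time t a k \<le> T}. u (r $ a k) (completion_time t a k))
        \<partial>action_measure \<sigma>)"

definition power_law_utility :: "real \<Rightarrow> real \<Rightarrow> real \<Rightarrow> real" where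
  "power_law_utility \<alpha> r t = r * t powr (- \<alpha>)"

text \<open>
  For \<open>0 \<le> \<alpha> \<le> 1\<close>, the order of growth of the total utility generated by time \<open>T\<close>.
\<close>

definition utility_growth :: "real \<Rightarrow> real \<Rightarrow> real" where
  "utility_growth \<alpha> T = (if \<alpha> < 1 then T powr (1 - \<alpha>) else ln T)"

definition optimal_strategy ::
  "real \<Rightarrow> real ^ 'a::finite \<Rightarrow> real ^ 'a \<Rightarrow> 'a strategy \<Rightarrow> bool" where
  "optimal_strategy \<alpha> r t \<sigma>' \<longleftrightarrow>
     (\<forall>\<sigma>. Limsup at_top (\<lambda>T.
        ereal ((expected_utility (power_law_utility \<alpha>) r t \<sigma> T
                - expected_utility (power_law_utility \<alpha>) r t \<sigma>' T) / utility_growth \<alpha> T)) \<le> 0)"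

definition stationary_equilibrium ::
  "real \<Rightarrow> real \<Rightarrow> real ^ 'a::finite \<Rightarrow> (real ^ 'a \<Rightarrow> real ^ 'a) \<Rightarrow> real ^ 'a \<Rightarrow> bool" where
  "stationary_equilibrium \<alpha> m r \<tau> \<mu> \<longleftrightarrow>
     \<mu> \<in> mass_simplex m \<and>
     (\<exists>p :: 'a pmf.
        (\<exists>\<theta>. \<forall>i. \<mu> $ i = \<theta> * pmf p i * \<tau> \<mu> $ i) \<and>
        optimal_strategy \<alpha> r (\<tau> \<mu>) (\<lambda>_. p))"

end

theory Submission
  imports Defs "HOL-Real_Asymp.Real_Asymp"
begin

text \<open>
  For a fixed mass distribution the sojourn times \<open>t\<close> are constants. Along every action sequence
  the sum of \<open>t $ a k * completion_time t a k powr - \<alpha>\<close> over the actions completed by time \<open>T\<close> is a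
  Riemann sum of \<open>x powr - \<alpha>\<close>, hence equal to the antiderivative at \<open>T\<close> up to an error that is
  bounded uniformly in the action sequence. Comparing \<open>r\<close> with \<open>\<rho> * t\<close>, where \<open>\<rho>\<close> is the best
  reward rate, no law of large numbers is needed: every strategy earns at most \<open>\<rho>\<close> times the
  growth plus a constant, a strategy that only takes actions of rate \<open>\<rho>\<close> earns this up to a
  constant, and a stationary strategy that takes some other action with positive probability
  loses a positive fraction. An equilibrium thus amounts to a solution of a variational
  inequality on the simplex, which exists by Brouwer's fixed point theorem.
\<close>

section \<open>The antiderivative of the discount factor\<close>

definition growth_integral :: "real \<Rightarrow> real \<Rightarrow> real" where
  "growth_integral \<alpha> x = (if \<alpha> < 1 then x powr (1 - \<alpha>) / (1 - \<alpha>) else ln x)"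

lemma DERIV_growth_integral:
  assumes "\<alpha> \<le> 1" "x > 0"
  shows "(growth_integral \<alpha> has_real_derivative x powr (- \<alpha>)) (at x)"
proof (cases "\<alpha> < 1")
  case True
  have "((\<lambda>x. x powr (1 - \<alpha>) / (1 - \<alpha>)) has_real_derivative x powr (- \<alpha>)) (at x)"
    using DERIV_cdivide[OF has_real_derivative_powr[OF assms(2), of "1 - \<alpha>"], of "1 - \<alpha>"] True
    by simp
  then show ?thesis using True by (simp add: growth_integral_def[abs_def])
next
  case False
  then show ?thesis using assms
    by (auto intro!: derivative_eq_intros simp: growth_integral_def[abs_def] powr_minus field_simps)
qed

text \<open>By the mean value theorem the increment is \<open>(y - x) * z powr (- \<alpha>)\<close>
  for some \<open>z\<close> between \<open>x\<close> and \<open>y\<close>, and the discount factor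
  does not increase.\<close>

lemma growth_integral_increment:
  assumes "0 \<le> \<alpha>" "\<alpha> \<le> 1" "0 < x" "x \<le> y"
  shows "(y - x) * y powr (- \<alpha>) \<le> growth_integral \<alpha> y - growth_integral \<alpha> x"
    and "growth_integral \<alpha> y - growth_integral \<alpha> x \<le> (y - x) * x powr (- \<alpha>)"
proof -
  have "(y - x) * y powr (- \<alpha>) \<le> growth_integral \<alpha> y - growth_integral \<alpha> x \<and>
    growth_integral \<alpha> y - growth_integral \<alpha> x \<le> (y - x) * x powr (- \<alpha>)"
  proof (cases "x = y")
    case False
    then have "\<exists>z. x < z \<and> z < y \<and>
        growth_integral \<alpha> y - growth_integral \<alpha> x = (y - x) * z powr (- \<alpha>)"
      using assms by (intro MVT2 DERIV_growth_integral) auto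
    then obtain z where z: "x < z" "z < y"
      "growth_integral \<alpha> y - growth_integral \<alpha> x = (y - x) * z powr (- \<alpha>)"
      by blast
    moreover have "y powr (- \<alpha>) \<le> z powr (- \<alpha>)" "z powr (- \<alpha>) \<le> x powr (- \<alpha>)"
      using z assms by (auto intro!: powr_mono2')
    ultimately show ?thesis using assms by (auto intro!: mult_left_mono)
  qed simp
  then show "(y - x) * y powr (- \<alpha>) \<le> growth_integral \<alpha> y - growth_integral \<alpha> x"
    and "growth_integral \<alpha> y - growth_integral \<alpha> x \<le> (y - x) * x powr (- \<alpha>)" by auto
qed

lemma growth_integral_mono:
  assumes "0 \<le> \<alpha>" "\<alpha> \<le> 1" "0 < x" "x \<le> y"
  shows "growth_integral \<alpha> x \<le> growth_integral \<alpha> y"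
proof -
  have "0 \<le> (y - x) * y powr (- \<alpha>)" using assms by simp
  then show ?thesis using growth_integral_increment(1)[OF assms] by linarith
qed

section \<open>Completion times and Riemann sums\<close>

lemma partial_sums_lower:
  fixes s :: "nat \<Rightarrow> real"
  assumes "\<And>k. lo \<le> s k"
  shows "real (Suc k) * lo \<le> (\<Sum>j\<le>k. s j)"
  using sum_mono[of "{..k}" "\<lambda>_. lo" s] assms by simp

lemma partial_sums_upper:
  fixes s :: "nat \<Rightarrow> real"
  assumes "\<And>k. s k \<le> hi"
  shows "(\<Sum>j\<le>k. s j) \<le> real (Suc k) * hi"
  using sum_mono[of "{..k}" s "\<lambda>_. hi"] assms by simp

lemma partial_sums_le_bound:
  fixes s :: "nat \<Rightarrow> real"
  assumes "0 < lo" "\<And>k. lo \<le> s k"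
  shows "{k. (\<Sum>j\<le>k. s j) \<le> T} \<subseteq> {..<nat \<lceil>T / lo\<rceil>}"
proof
  fix k assume "k \<in> {k. (\<Sum>j\<le>k. s j) \<le> T}"
  then have "real (Suc k) * lo \<le> T"
    using partial_sums_lower[of lo s k] assms by fastforce
  then have "real (Suc k) \<le> T / lo" using assms by (simp add: field_simps)
  then show "k \<in> {..<nat \<lceil>T / lo\<rceil>}" by simp linarith
qed

text \<open>The partial sums increase and eventually exceed \<open>T\<close>, so there is a last
  index \<open>n\<close> below \<open>T\<close>; \<open>s 0 \<le> T\<close> provides at least
  one.\<close>

lemma partial_sums_le_atMost:
  fixes s :: "nat \<Rightarrow> real"
  assumes "0 < lo" "\<And>k. lo \<le> s k" "s 0 \<le> T"
  obtains n where "{k. (\<Sum>j\<le>k. s j) \<le> T} = {..n}" "(\<Sum>j\<le>n. s j) \<le> T" "T < (\<Sum>j\<le>Suc n. s j)"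
proof -
  let ?S = "{k. (\<Sum>j\<le>k. s j) \<le> T}"
  have fin: "finite ?S"
    using assms(1,2) by (intro finite_subset[OF partial_sums_le_bound[of lo s]]) auto
  have ne: "0 \<in> ?S" using assms by simp
  have mono: "(\<Sum>j\<le>k. s j) \<le> (\<Sum>j\<le>l. s j)" if "k \<le> l" for k l
  proof (rule sum_mono2)
    fix j show "0 \<le> s j" using assms(1) assms(2)[of j] by linarith
  qed (use that in auto)
  define n where "n = Max ?S"
  have n: "n \<in> ?S" unfolding n_def by (rule Max_in[OF fin]) (use ne in blast)
  have up: "k \<le> n" if "k \<in> ?S" for k using that fin unfolding n_def by simp
  have "?S = {..n}"
  proof (intro equalityI subsetI)
    fix k assume "k \<in> {..n}"
    then show "k \<in> ?S" using n mono[of k n] by simp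
  qed (use up in auto)
  moreover have "T < (\<Sum>j\<le>Suc n. s j)" using up[of "Suc n"] by fastforce
  moreover have "(\<Sum>j\<le>n. s j) \<le> T" using n by simp
  ultimately show thesis using that by blast
qed

text \<open>
  A left and a right Riemann sum of \<open>x powr - \<alpha>\<close> with the same partition, whose mesh is at most
  \<open>hi\<close>, differ by at most \<open>hi\<close> times the total variation.
\<close>

lemma discounted_sum_bounds:
  fixes s :: "nat \<Rightarrow> real"
  defines "\<theta> k \<equiv> (\<Sum>j\<le>k. s j)"
  assumes \<alpha>: "0 \<le> \<alpha>" "\<alpha> \<le> 1" and lo: "0 < lo" and s: "\<And>k. lo \<le> s k" "\<And>k. s k \<le> hi"
  shows "(\<Sum>k\<le>n. s k * \<theta> k powr (- \<alpha>))
           \<le> \<theta> 0 powr (1 - \<alpha>) + growth_integral \<alpha> (\<theta> n) - growth_integral \<alpha> (\<theta> 0)"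
    and "growth_integral \<alpha> (\<theta> n) - growth_integral \<alpha> (\<theta> 0)
           - hi * (\<theta> 0 powr (- \<alpha>) - \<theta> n powr (- \<alpha>)) \<le> (\<Sum>k\<le>n. s k * \<theta> k powr (- \<alpha>))"
proof -
  have Suc: "\<theta> (Suc n) = \<theta> n + s (Suc n)" for n by (simp add: \<theta>_def)
  have pos: "0 < \<theta> n" for n
  proof -
    have "0 < real (Suc n) * lo" using lo by simp
    then show ?thesis using partial_sums_lower[of lo s n, OF s(1)] unfolding \<theta>_def by linarith
  qed
  have spos: "0 < s n" for n using lo s(1)[of n] by linarith
  note inc = growth_integral_increment[OF \<alpha> pos, of _ "\<theta> (Suc _)"]
  show "(\<Sum>k\<le>n. s k * \<theta> k powr (- \<alpha>))
           \<le> \<theta> 0 powr (1 - \<alpha>) + growth_integral \<alpha> (\<theta> n) - growth_integral \<alpha> (\<theta> 0)"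
  proof (induction n)
    case 0
    \<comment> \<open>No partition point precedes \<open>\<theta> 0\<close>, because the
      antiderivative is singular at 0 for \<open>\<alpha> = 1\<close>; the first term is therefore
      kept separately.\<close>
    have "s 0 * s 0 powr (- \<alpha>) = s 0 powr (1 - \<alpha>)"
      using spos[of 0] by (simp add: powr_diff powr_minus field_simps)
    then show ?case by (simp add: \<theta>_def)
  next
    case (Suc n)
    have "s (Suc n) * \<theta> (Suc n) powr (- \<alpha>) \<le> growth_integral \<alpha> (\<theta> (Suc n)) - growth_integral \<alpha> (\<theta> n)"
      using inc(1)[of n n] \<open>\<And>n. \<theta> (Suc n) = \<theta> n + s (Suc n)\<close> spos[of "Suc n"] by simp
    then show ?case using Suc by simp
  qed
  show "growth_integral \<alpha> (\<theta> n) - growth_integral \<alpha> (\<theta> 0)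
           - hi * (\<theta> 0 powr (- \<alpha>) - \<theta> n powr (- \<alpha>)) \<le> (\<Sum>k\<le>n. s k * \<theta> k powr (- \<alpha>))"
  proof (induction n)
    case 0
    show ?case using spos[of 0] by simp
  next
    case (Suc n)
    have step: "\<theta> (Suc n) = \<theta> n + s (Suc n)" by (simp add: \<theta>_def)
    have "growth_integral \<alpha> (\<theta> (Suc n)) - growth_integral \<alpha> (\<theta> n) \<le> s (Suc n) * \<theta> n powr (- \<alpha>)"
      using inc(2)[of n n] step spos[of "Suc n"] by simp
    \<comment> \<open>The discount factor does not increase along the partition, so the step can be
      enlarged to \<open>hi\<close>, after which the errors telescope.\<close>
    moreover have "\<theta> (Suc n) powr (- \<alpha>) \<le> \<theta> n powr (- \<alpha>)"
      using \<alpha> pos step spos[of "Suc n"] by (intro powr_mono2') auto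
    then have "s (Suc n) * (\<theta> n powr (- \<alpha>) - \<theta> (Suc n) powr (- \<alpha>))
        \<le> hi * (\<theta> n powr (- \<alpha>) - \<theta> (Suc n) powr (- \<alpha>))"
      using s by (intro mult_right_mono) auto
    ultimately show ?case using Suc by (simp add: algebra_simps)
  qed
qed

text \<open>The terms bound, in order: the first summand, the antiderivative at the first completion
  time (which lies between \<open>lo\<close> and \<open>hi\<close>), and, once each, the gap between
  left and right sums and the part after the last completion. Neither \<open>T\<close> nor the
  sequence enters.\<close>

definition riemann_error :: "real \<Rightarrow> real \<Rightarrow> real \<Rightarrow> real" where
  "riemann_error \<alpha> lo hi = \<bar>hi powr (1 - \<alpha>)\<bar> + \<bar>growth_integral \<alpha> lo\<bar> + \<bar>growth_integral \<alpha> hi\<bar>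
     + 2 * (hi * lo powr (- \<alpha>))"

text \<open>The completed indices are \<open>{..n}\<close>, so the Riemann bounds apply up to
  \<open>\<theta> n\<close>. The rest, from \<open>\<theta> n\<close> to \<open>T\<close>, is
  shorter than one sojourn time.\<close>

lemma discounted_sum_approx:
  fixes s :: "nat \<Rightarrow> real"
  assumes \<alpha>: "0 \<le> \<alpha>" "\<alpha> \<le> 1" and lo: "0 < lo"
    and s: "\<And>k. lo \<le> s k" "\<And>k. s k \<le> hi" and T: "hi \<le> T"
  shows "\<bar>(\<Sum>k\<in>{k. (\<Sum>j\<le>k. s j) \<le> T}. s k * (\<Sum>j\<le>k. s j) powr (- \<alpha>))
    - growth_integral \<alpha> T\<bar> \<le> riemann_error \<alpha> lo hi"
proof -
  let ?G = "growth_integral \<alpha>"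
  have hi: "lo \<le> hi" using order_trans[OF s] .
  have hilo: "0 \<le> hi * lo powr (- \<alpha>)" using lo hi by simp
  define \<theta> where "\<theta> k = (\<Sum>j\<le>k. s j)" for k
  have "s 0 \<le> T" using s(2)[of 0] T by linarith
  then obtain n where n: "{k. \<theta> k \<le> T} = {..n}" "\<theta> n \<le> T" "T < \<theta> (Suc n)"
    unfolding \<theta>_def by (rule partial_sums_le_atMost[where s = s, OF lo s(1)])
  note b = discounted_sum_bounds[where s = s and n = n, OF \<alpha> lo s, folded \<theta>_def]
  have \<theta>0: "lo \<le> \<theta> 0" "\<theta> 0 \<le> hi" using s by (auto simp: \<theta>_def)
  have \<theta>n: "lo \<le> \<theta> n"
  proof -
    have "1 * lo \<le> real (Suc n) * lo" using lo by (intro mult_right_mono) auto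
    also have "\<dots> \<le> \<theta> n" unfolding \<theta>_def by (rule partial_sums_lower) (rule s(1))
    finally show ?thesis by simp
  qed
  have "?G lo \<le> ?G (\<theta> 0)" "?G (\<theta> 0) \<le> ?G hi" "?G (\<theta> n) \<le> ?G T"
    using \<alpha> lo \<theta>0 n \<theta>n by (auto intro!: growth_integral_mono)
  moreover have "\<theta> 0 powr (1 - \<alpha>) \<le> hi powr (1 - \<alpha>)"
    using \<alpha> lo \<theta>0 by (intro powr_mono2) auto
  moreover have "hi * (\<theta> 0 powr (- \<alpha>) - \<theta> n powr (- \<alpha>)) \<le> hi * lo powr (- \<alpha>)"
  proof (intro mult_left_mono)
    have "\<theta> 0 powr (- \<alpha>) \<le> lo powr (- \<alpha>)" using \<alpha> lo \<theta>0 by (intro powr_mono2') auto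
    then show "\<theta> 0 powr (- \<alpha>) - \<theta> n powr (- \<alpha>) \<le> lo powr (- \<alpha>)"
      using powr_ge_zero[of "\<theta> n" "- \<alpha>"] by linarith
  qed (use lo hi in auto)
  moreover have "?G T - ?G (\<theta> n) \<le> hi * lo powr (- \<alpha>)"
  proof -
    have "T - \<theta> n \<le> hi" using n(3) s(2)[of "Suc n"] by (simp add: \<theta>_def)
    moreover have "\<theta> n powr (- \<alpha>) \<le> lo powr (- \<alpha>)" using \<alpha> lo \<theta>n by (intro powr_mono2') auto
    ultimately have "(T - \<theta> n) * \<theta> n powr (- \<alpha>) \<le> hi * lo powr (- \<alpha>)"
      using n lo hi by (intro mult_mono) auto
    then show ?thesis
      using growth_integral_increment(2)[OF \<alpha>, of "\<theta> n" T] lo \<theta>n n by linarith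
  qed
  ultimately have "\<bar>(\<Sum>k\<le>n. s k * \<theta> k powr (- \<alpha>)) - ?G T\<bar> \<le> riemann_error \<alpha> lo hi"
    using b hilo unfolding riemann_error_def by linarith
  then show ?thesis
    using n(1) unfolding \<theta>_def by simp
qed

text \<open>The factor is \<open>1 / (1 - \<alpha>)\<close>, or 1 in the logarithmic case; it
  converts the integral into the normalisation used for optimality.\<close>

lemma growth_integral_eq_utility_growth:
  "\<exists>c>0. \<forall>T. growth_integral \<alpha> T = c * utility_growth \<alpha> T"
  by (rule exI[of _ "if \<alpha> < 1 then 1 / (1 - \<alpha>) else 1"])
     (auto simp: growth_integral_def utility_growth_def)

lemma filterlim_utility_growth:
  "filterlim (utility_growth \<alpha>) at_top at_top"
proof (cases "\<alpha> < 1")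
  case True
  have "filterlim (\<lambda>T::real. T powr (1 - \<alpha>)) at_top at_top"
    using True by real_asymp
  then show ?thesis using True by (simp add: utility_growth_def[abs_def])
next
  case False
  then show ?thesis using ln_at_top by (simp add: utility_growth_def[abs_def])
qed

section \<open>A variational inequality on the simplex\<close>

lemma convex_mass_simplex: "convex (mass_simplex s :: (real ^ 'a::finite) set)"
proof (rule convexI)
  fix x y :: "real ^ 'a" and u v :: real
  assume *: "x \<in> mass_simplex s" "y \<in> mass_simplex s" "0 \<le> u" "0 \<le> v" "u + v = 1"
  have "(\<Sum>i\<in>UNIV. (u *\<^sub>R x + v *\<^sub>R y) $ i) = (u + v) * s"
    using *(1,2) by (simp add: mass_simplex_def sum.distrib distrib_right flip: sum_distrib_left)
  then show "u *\<^sub>R x + v *\<^sub>R y \<in> mass_simplex s"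
    using * by (simp add: mass_simplex_def)
qed

lemma compact_mass_simplex: "compact (mass_simplex s :: (real ^ 'a::finite) set)"
proof -
  have "closed (mass_simplex s :: (real ^ 'a) set)"
    unfolding mass_simplex_def
    by (intro closed_Collect_conj closed_Collect_all closed_Collect_le closed_Collect_eq
        continuous_intros)
  moreover have "bounded (mass_simplex s :: (real ^ 'a) set)"
    unfolding bounded_iff
  proof (intro exI ballI)
    fix \<mu> :: "real ^ 'a" assume "\<mu> \<in> mass_simplex s"
    then have "(\<Sum>i\<in>UNIV. \<bar>\<mu> $ i\<bar>) = s" by (simp add: mass_simplex_def)
    then show "norm \<mu> \<le> s" using norm_le_l1_cart[of \<mu>] by simp
  qed
  ultimately show ?thesis by (simp add: compact_eq_bounded_closed)
qed

text \<open>
  A fixed point of the projection of \<open>\<mu> + F \<mu>\<close> onto the simplex solves the variational inequality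
  for \<open>F\<close>, tested here by moving the whole mass of one coordinate to another one.
\<close>

lemma ex_maximal_on_support:
  fixes F :: "real ^ 'a::finite \<Rightarrow> real ^ 'a"
  assumes "0 \<le> m" and F: "continuous_on (mass_simplex m) F"
  shows "\<exists>\<mu>\<in>mass_simplex m. \<forall>i j. 0 < \<mu> $ i \<longrightarrow> F \<mu> $ j \<le> F \<mu> $ i"
proof -
  let ?S = "mass_simplex m :: (real ^ 'a) set"
  let ?f = "\<lambda>\<mu>. closest_point ?S (\<mu> + F \<mu>)"
  \<comment> \<open>This picks an arbitrary action; the corresponding vertex shows that the simplex
    is nonempty.\<close>
  obtain i0 :: 'a where True by simp
  have "axis i0 m \<in> ?S" using \<open>0 \<le> m\<close> by (auto simp: mass_simplex_def axis_def)
  then have ne: "?S \<noteq> {}" by blast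
  have cl: "closed ?S" by (rule compact_imp_closed[OF compact_mass_simplex])
  have "continuous_on ?S ?f"
    by (rule continuous_on_compose2[OF continuous_on_closest_point[OF convex_mass_simplex cl ne]])
       (auto intro!: continuous_intros F)
  moreover have "?f \<in> ?S \<rightarrow> ?S" using closest_point_in_set[OF cl ne] by auto
  ultimately obtain \<mu> where \<mu>: "\<mu> \<in> ?S" "?f \<mu> = \<mu>"
    by (rule brouwer[OF compact_mass_simplex convex_mass_simplex ne])
  have "F \<mu> $ j \<le> F \<mu> $ i" if i: "0 < \<mu> $ i" for i j
  proof (cases "i = j")
    case False
    let ?\<nu> = "\<mu> + axis j (\<mu> $ i) - axis i (\<mu> $ i)"
    have "?\<nu> \<in> ?S"
      using \<mu>(1) by (auto simp: mass_simplex_def axis_def sum.distrib sum_subtractf)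
    \<comment> \<open>The residual of the projection of \<open>\<mu> + F \<mu>\<close> is
      \<open>F \<mu>\<close> itself, and it makes no acute angle with a direction into the
      simplex.\<close>
    from closest_point_dot[OF convex_mass_simplex cl this, of "\<mu> + F \<mu>"]
    have "F \<mu> \<bullet> (axis j (\<mu> $ i) - axis i (\<mu> $ i)) \<le> 0" using \<mu>(2) by simp
    then have "(F \<mu> $ j - F \<mu> $ i) * \<mu> $ i \<le> 0"
      by (simp add: inner_diff_right inner_axis algebra_simps)
    then show ?thesis using i by (simp add: mult_le_0_iff)
  qed simp
  then show ?thesis using \<mu>(1) by blast
qed

section \<open>Random action sequences\<close>

lemma prob_space_action_measure: "prob_space (action_measure \<sigma>)"
  unfolding action_measure_def by (intro prob_space_PiM prob_space_measure_pmf)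

lemma measurable_action [measurable]:
  "(\<lambda>a. a k) \<in> measurable (action_measure \<sigma>) (count_space UNIV)"
proof -
  have "(\<lambda>a. a k) \<in> measurable (action_measure \<sigma>) (measure_pmf (\<sigma> k))"
    unfolding action_measure_def by (rule measurable_component_singleton) simp
  then show ?thesis by (simp cong: measurable_cong_sets)
qed

text \<open>Each coordinate follows its own pmf, and the countably many exceptional null sets can be
  merged.\<close>

lemma AE_action_in_set_pmf: "AE a in action_measure \<sigma>. \<forall>k. a k \<in> set_pmf (\<sigma> k)"
  unfolding AE_all_countable action_measure_def
  by (intro allI AE_PiM_component prob_space_measure_pmf) (auto simp: AE_measure_pmf)

lemma integral_action:
  fixes f :: "'a \<Rightarrow> real"
  shows "(\<integral>a. f (a k) \<partial>action_measure \<sigma>) = measure_pmf.expectation (\<sigma> k) f"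
proof -
  have "measure_pmf.expectation (\<sigma> k) f
      = integral\<^sup>L (distr (action_measure \<sigma>) (measure_pmf (\<sigma> k)) (\<lambda>a. a k)) f"
    unfolding action_measure_def by (subst distr_PiM_component) (auto intro: prob_space_measure_pmf)
  also have "\<dots> = (\<integral>a. f (a k) \<partial>action_measure \<sigma>)"
    using measurable_action[of k \<sigma>] by (intro integral_distr) (auto cong: measurable_cong_sets)
  finally show ?thesis by simp
qed

section \<open>Utilities for fixed sojourn times\<close>

locale positive_sojourn_times =
  fixes \<alpha> :: real and t :: "real ^ 'a::finite"
  assumes \<alpha>: "0 \<le> \<alpha>" "\<alpha> \<le> 1" and t_pos: "\<And>i. 0 < t $ i"
begin

definition shortest :: real where "shortest = Min (range (($) t))"

definition longest :: real where "longest = Max (range (($) t))"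

text \<open>The integrand of \<open>expected_utility\<close>, with the reward vector as an argument:
  it is linear in \<open>r\<close>, and is also evaluated at vectors other than the rewards of the
  game, such as \<open>t\<close> and \<open>axis i d\<close>.\<close>

definition path_utility :: "real ^ 'a \<Rightarrow> (nat \<Rightarrow> 'a) \<Rightarrow> real \<Rightarrow> real" where
  "path_utility r a T = (\<Sum>k\<in>{k. completion_time t a k \<le> T}.
     power_law_utility \<alpha> (r $ a k) (completion_time t a k))"

lemma shortest_pos: "0 < shortest"
  using t_pos by (simp add: shortest_def)

lemma shortest_le: "shortest \<le> t $ i"
  by (simp add: shortest_def)

lemma le_longest: "t $ i \<le> longest"
  by (simp add: longest_def)

lemma shortest_le_longest: "shortest \<le> longest"
  using order_trans[OF shortest_le le_longest] .

lemma completion_time_ge: "real (Suc k) * shortest \<le> completion_time t a k"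
  unfolding completion_time_def by (rule partial_sums_lower) (rule shortest_le)

lemma completion_time_le: "completion_time t a k \<le> real (Suc k) * longest"
  unfolding completion_time_def by (rule partial_sums_upper) (rule le_longest)

lemma completion_time_ge_shortest: "shortest \<le> completion_time t a k"
proof -
  have "1 * shortest \<le> real (Suc k) * shortest"
    using shortest_pos by (intro mult_right_mono) auto
  then show ?thesis using completion_time_ge[of k a] by simp
qed

lemma completed_subset: "{k. completion_time t a k \<le> T} \<subseteq> {..<nat \<lceil>T / shortest\<rceil>}"
  unfolding completion_time_def by (rule partial_sums_le_bound[OF shortest_pos]) (rule shortest_le)

lemma finite_completed: "finite {k. completion_time t a k \<le> T}"
  using completed_subset finite_subset by blast

text \<open>The set of completed indices depends on the path. Summing over a fixed finite range
  allows integrability to be checked term by term.\<close>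

lemma path_utility_lessThan:
  "path_utility r a T = (\<Sum>k<nat \<lceil>T / shortest\<rceil>. if completion_time t a k \<le> T
     then power_law_utility \<alpha> (r $ a k) (completion_time t a k) else 0)"
proof -
  have "{k \<in> {..<nat \<lceil>T / shortest\<rceil>}. completion_time t a k \<le> T} = {k. completion_time t a k \<le> T}"
    using completed_subset by auto
  then show ?thesis unfolding path_utility_def by (simp flip: sum.inter_filter)
qed

lemma integrable_path_utility: "integrable (action_measure \<sigma>) (\<lambda>a. path_utility r a T)"
  unfolding path_utility_lessThan
proof (intro Bochner_Integration.integrable_sum)
  fix k
  interpret prob_space "action_measure \<sigma>" by (rule prob_space_action_measure)
  let ?f = "\<lambda>a. if completion_time t a k \<le> T
     then power_law_utility \<alpha> (r $ a k) (completion_time t a k) else 0"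
  show "integrable (action_measure \<sigma>) ?f"
  \<comment> \<open>Every completion time is at least \<open>shortest\<close>, which bounds the
    discount factor.\<close>
  proof (rule integrable_const_bound[of _ "norm r * shortest powr (- \<alpha>)"])
    show "AE a in action_measure \<sigma>. norm (?f a) \<le> norm r * shortest powr (- \<alpha>)"
      using \<alpha> shortest_pos completion_time_ge_shortest
      by (intro AE_I2) (auto simp: power_law_utility_def abs_mult component_le_norm_cart
            intro!: mult_mono powr_mono2')
    show "?f \<in> borel_measurable (action_measure \<sigma>)"
      unfolding completion_time_def power_law_utility_def by measurable
  qed
qed

lemma expected_utility_eq:
  "expected_utility (power_law_utility \<alpha>) r t \<sigma> T = (\<integral>a. path_utility r a T \<partial>action_measure \<sigma>)"
  by (simp add: expected_utility_def path_utility_def)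

text \<open>When each action is paid its own duration, the path utility is a right Riemann sum of
  the discount factor, whatever the path.\<close>

lemma path_utility_sojourn_times_approx:
  assumes "longest \<le> T"
  shows "\<bar>path_utility t a T - growth_integral \<alpha> T\<bar> \<le> riemann_error \<alpha> shortest longest"
  using discounted_sum_approx[OF \<alpha> shortest_pos, of "\<lambda>k. t $ a k" longest T]
    shortest_le le_longest assms
  by (simp add: path_utility_def completion_time_def power_law_utility_def)

text \<open>The rewards are compared only at actions that occur in \<open>a\<close>, so the lemma
  applies to paths confined to the support of a strategy.\<close>

lemma path_utility_mono:
  assumes "\<And>k. r $ a k \<le> r' $ a k"
  shows "path_utility r a T \<le> path_utility r' a T"
  unfolding path_utility_def power_law_utility_def
  using assms by (intro sum_mono mult_right_mono) auto

lemma path_utility_scale: "path_utility (\<rho> *\<^sub>R r) a T = \<rho> * path_utility r a T"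
  unfolding path_utility_def power_law_utility_def by (simp add: sum_distrib_left mult.assoc)

lemma path_utility_diff: "path_utility (r - r') a T = path_utility r a T - path_utility r' a T"
  unfolding path_utility_def power_law_utility_def by (simp add: left_diff_distrib sum_subtractf)

text \<open>Replacing completion times by their upper bounds \<open>real (Suc k) * longest\<close>
  lowers the discount factors and drops indices; both only decrease a nonnegative sum. The weights
  become deterministic.\<close>

lemma path_utility_single_action_ge:
  assumes "0 \<le> d"
  shows "(\<Sum>k\<in>{k. real (Suc k) * longest \<le> T}.
      d * indicator {i} (a k) * (real (Suc k) * longest) powr (- \<alpha>)) \<le> path_utility (axis i d) a T"
proof -
  have pos: "0 < completion_time t a k" for k
    using completion_time_ge_shortest[of a k] shortest_pos by linarith
  have "(\<Sum>k\<in>{k. real (Suc k) * longest \<le> T}.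
      d * indicator {i} (a k) * (real (Suc k) * longest) powr (- \<alpha>))
    \<le> (\<Sum>k\<in>{k. real (Suc k) * longest \<le> T}.
      d * indicator {i} (a k) * completion_time t a k powr (- \<alpha>))"
    using assms \<alpha> pos by (intro sum_mono mult_left_mono powr_mono2' completion_time_le) auto
  also have "\<dots> \<le> (\<Sum>k\<in>{k. completion_time t a k \<le> T}.
      d * indicator {i} (a k) * completion_time t a k powr (- \<alpha>))"
    using assms by (intro sum_mono2 finite_completed)
      (auto intro: order_trans[OF completion_time_le])
  also have "\<dots> = path_utility (axis i d) a T"
    unfolding path_utility_def power_law_utility_def
    by (intro sum.cong) (auto simp: axis_def)
  finally show ?thesis .
qed

text \<open>
  Whatever the other actions are, the (\<open>k\<close>+1)-st action is completed by time \<open>(k + 1) * longest\<close>,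
  so only the marginal distributions of the actions matter here.
\<close>

lemma expected_utility_single_action_ge:
  assumes d: "0 \<le> d" and T: "longest \<le> T"
  shows "d * pmf p i / longest * (growth_integral \<alpha> T - riemann_error \<alpha> longest longest)
    \<le> (\<integral>a. path_utility (axis i d) a T \<partial>action_measure (\<lambda>_. p))"
proof -
  have lpos: "0 < longest" using shortest_pos shortest_le_longest by linarith
  interpret prob_space "action_measure (\<lambda>_. p)" by (rule prob_space_action_measure)
  let ?K = "{k. real (Suc k) * longest \<le> T}"
  let ?w = "\<lambda>k. (real (Suc k) * longest) powr (- \<alpha>)"
  have int: "integrable (action_measure (\<lambda>_. p)) (\<lambda>a. d * indicator {i} (a k) * ?w k)" for k
    by (rule integrable_const_bound[of _ "d * ?w k"])
       (use d in \<open>auto simp: indicator_def\<close>)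
  \<comment> \<open>The deterministic weights form the Riemann sum for the constant sojourn time
    \<open>longest\<close>, hence the error term with both bounds equal.\<close>
  have "d * pmf p i / longest * (growth_integral \<alpha> T - riemann_error \<alpha> longest longest)
      \<le> d * pmf p i / longest * (\<Sum>k\<in>?K. longest * ?w k)"
    using discounted_sum_approx[OF \<alpha> lpos, of "\<lambda>_. longest" longest T] T d lpos
    by (intro mult_left_mono) auto
  also have "\<dots> = (\<Sum>k\<in>?K. d * pmf p i * ?w k)"
    using lpos by (simp add: sum_distrib_left field_simps)
  also have "\<dots> = (\<Sum>k\<in>?K. \<integral>a. d * indicator {i} (a k) * ?w k \<partial>action_measure (\<lambda>_. p))"
  proof (intro sum.cong refl)
    fix k
    have "(\<integral>a. d * indicator {i} (a k) * ?w k \<partial>action_measure (\<lambda>_. p))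
        = measure_pmf.expectation p (\<lambda>x. d * indicator {i} x * ?w k)"
      by (rule integral_action)
    also have "\<dots> = d * pmf p i * ?w k" by (simp add: measure_pmf_single)
    finally show "d * pmf p i * ?w k = (\<integral>a. d * indicator {i} (a k) * ?w k \<partial>action_measure (\<lambda>_. p))"
      by (rule sym)
  qed
  also have "\<dots> = (\<integral>a. (\<Sum>k\<in>?K. d * indicator {i} (a k) * ?w k) \<partial>action_measure (\<lambda>_. p))"
    by (rule Bochner_Integration.integral_sum[symmetric]) (rule int)
  also have "\<dots> \<le> (\<integral>a. path_utility (axis i d) a T \<partial>action_measure (\<lambda>_. p))"
    using int integrable_path_utility path_utility_single_action_ge[OF d]
    by (intro integral_mono Bochner_Integration.integrable_sum) auto
  finally show ?thesis .
qed

section \<open>Optimality of stationary strategies\<close>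

lemma tendsto_const_over_utility_growth: "((\<lambda>T. K / utility_growth \<alpha> T) \<longlongrightarrow> 0) at_top"
  by (intro tendsto_divide_0[OF tendsto_const] filterlim_at_top_imp_at_infinity
      filterlim_utility_growth)

text \<open>With only best actions in the support, no strategy gains more than a constant over
  \<open>p\<close>, which vanishes after division by the growth. Otherwise, always taking one best
  action beats \<open>p\<close> by a positive multiple of the growth.\<close>

lemma optimal_stationary_iff:
  assumes r_pos: "\<And>i. 0 < r $ i"
  shows "optimal_strategy \<alpha> r t (\<lambda>_. p) \<longleftrightarrow>
    (\<forall>i\<in>set_pmf p. \<forall>j. r $ j / t $ j \<le> r $ i / t $ i)"
proof -
  let ?E = "expected_utility (power_law_utility \<alpha>) r t"
  let ?G = "growth_integral \<alpha>"
  let ?g = "utility_growth \<alpha>"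
  define \<rho> where "\<rho> = Max (range (\<lambda>i. r $ i / t $ i))"
  have "\<rho> \<in> range (\<lambda>i. r $ i / t $ i)" unfolding \<rho>_def by (intro Max_in) auto
  then obtain best where best: "\<rho> = r $ best / t $ best" by auto
  have \<rho>_ge: "r $ i / t $ i \<le> \<rho>" for i by (simp add: \<rho>_def)
  have \<rho>_nonneg: "0 \<le> \<rho>" using best r_pos[of best] t_pos[of best] by simp
  \<comment> \<open>This reduces arbitrary rewards to payment by duration at rate
    \<open>\<rho>\<close>; equality holds exactly for best actions.\<close>
  have r_le: "r $ i \<le> (\<rho> *\<^sub>R t) $ i" for i
    using \<rho>_ge[of i] t_pos[of i] by (simp add: field_simps)
  define C where "C = riemann_error \<alpha> shortest longest"
  define C' where "C' = riemann_error \<alpha> longest longest"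
  note C = path_utility_sojourn_times_approx[folded C_def]
  obtain c where c: "c > 0" "\<And>T. ?G T = c * ?g T"
    using growth_integral_eq_utility_growth[of \<alpha>] by blast
  have upper: "path_utility (\<rho> *\<^sub>R t) a T \<le> \<rho> * (?G T + C)" if "longest \<le> T" for a T
    unfolding path_utility_scale
    using C[OF that, of a] \<rho>_nonneg by (intro mult_left_mono) linarith+
  have E_upper: "?E \<sigma> T \<le> \<rho> * (?G T + C)" if "longest \<le> T" for \<sigma> T
  proof -
    interpret prob_space "action_measure \<sigma>" by (rule prob_space_action_measure)
    have "?E \<sigma> T \<le> (\<integral>a. \<rho> * (?G T + C) \<partial>action_measure \<sigma>)"
      unfolding expected_utility_eq
      using order_trans[OF path_utility_mono upper[OF that]] r_le integrable_path_utility
      by (intro integral_mono) auto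
    then show ?thesis by (simp add: prob_space)
  qed
  have E_lower: "\<rho> * (?G T - C) \<le> ?E \<sigma> T"
    if "longest \<le> T" and best: "\<And>k i. i \<in> set_pmf (\<sigma> k) \<Longrightarrow> r $ i / t $ i = \<rho>" for \<sigma> T
  proof -
    interpret prob_space "action_measure \<sigma>" by (rule prob_space_action_measure)
    have "(\<integral>a. \<rho> * (?G T - C) \<partial>action_measure \<sigma>) \<le> ?E \<sigma> T"
      unfolding expected_utility_eq
    proof (intro integral_mono_AE integrable_path_utility)
      show "AE a in action_measure \<sigma>. \<rho> * (?G T - C) \<le> path_utility r a T"
        using AE_action_in_set_pmf
      proof eventually_elim
        case (elim a)
        have "(\<rho> *\<^sub>R t) $ a k \<le> r $ a k" for k
          using best[of "a k" k] elim t_pos[of "a k"] by (auto simp: field_simps)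
        from path_utility_mono[OF this] have "\<rho> * path_utility t a T \<le> path_utility r a T"
          by (simp add: path_utility_scale)
        moreover have "\<rho> * (?G T - C) \<le> \<rho> * path_utility t a T"
          using C[OF that(1), of a] \<rho>_nonneg by (intro mult_left_mono) linarith+
        ultimately show ?case by linarith
      qed
    qed auto
    then show ?thesis by (simp add: prob_space)
  qed
  \<comment> \<open>For small \<open>T\<close> the first action may be unfinished and the logarithm
    negative.\<close>
  have ev: "\<forall>\<^sub>F T in at_top. longest \<le> T \<and> 0 < ?g T"
    using eventually_ge_at_top[of longest] filterlim_utility_growth[of \<alpha>]
    by (auto simp: filterlim_at_top_dense eventually_conj_iff)
  show ?thesis
  proof
    assume best_supp: "\<forall>i\<in>set_pmf p. \<forall>j. r $ j / t $ j \<le> r $ i / t $ i"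
    have "r $ i / t $ i = \<rho>" if "i \<in> set_pmf p" for i
      using best_supp that \<rho>_ge[of i] best by (auto intro: antisym)
    then have lower: "\<rho> * (?G T - C) \<le> ?E (\<lambda>_. p) T" if "longest \<le> T" for T
      using that by (intro E_lower)
    show "optimal_strategy \<alpha> r t (\<lambda>_. p)"
      unfolding optimal_strategy_def
    proof
      fix \<sigma>
      have "Limsup at_top (\<lambda>T. ereal ((?E \<sigma> T - ?E (\<lambda>_. p) T) / ?g T))
          \<le> Limsup at_top (\<lambda>T. ereal (2 * \<rho> * C / ?g T))"
      proof (intro Limsup_mono eventually_mono[OF ev])
        fix T assume T: "longest \<le> T \<and> 0 < ?g T"
        then have "?E \<sigma> T - ?E (\<lambda>_. p) T \<le> 2 * \<rho> * C"
          using E_upper[of T \<sigma>] lower[of T] by (simp add: algebra_simps)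
        then show "ereal ((?E \<sigma> T - ?E (\<lambda>_. p) T) / ?g T) \<le> ereal (2 * \<rho> * C / ?g T)"
          using T by (simp add: divide_right_mono)
      qed
      also have "\<dots> = ereal 0"
        by (intro lim_imp_Limsup tendsto_ereal tendsto_const_over_utility_growth) simp
      finally show "Limsup at_top (\<lambda>T. ereal ((?E \<sigma> T - ?E (\<lambda>_. p) T) / ?g T)) \<le> 0"
        by (simp add: zero_ereal_def)
    qed
  next
    assume opt: "optimal_strategy \<alpha> r t (\<lambda>_. p)"
    show "\<forall>i\<in>set_pmf p. \<forall>j. r $ j / t $ j \<le> r $ i / t $ i"
    proof (rule ccontr)
      assume "\<not> ?thesis"
      then obtain i j where i: "i \<in> set_pmf p" and "r $ i / t $ i < r $ j / t $ j"
        by (auto simp: not_le)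
      then have "r $ i / t $ i < \<rho>" using \<rho>_ge[of j] by linarith
      \<comment> \<open>\<open>d\<close> is the loss of one use of \<open>i\<close> against payment
        at rate \<open>\<rho>\<close>; \<open>\<delta>\<close> below bounds from below the expected
        loss per unit of \<open>?G T\<close>, up to a constant.\<close>
      define d where "d = \<rho> * t $ i - r $ i"
      have d: "0 < d" using \<open>r $ i / t $ i < \<rho>\<close> t_pos[of i] by (simp add: d_def field_simps)
      define \<delta> where "\<delta> = d * pmf p i / longest"
      have \<delta>: "0 < \<delta>"
        using d i shortest_pos shortest_le_longest by (auto simp: \<delta>_def pmf_positive)
      have E_p: "?E (\<lambda>_. p) T \<le> \<rho> * (?G T + C) - \<delta> * (?G T - C')" if T: "longest \<le> T" for T
      proof -
        interpret prob_space "action_measure (\<lambda>_. p)" by (rule prob_space_action_measure)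
        \<comment> \<open>Equality holds at \<open>i\<close>: the loss there is kept, while all
          other actions are treated as if they were best.\<close>
        have "r $ k \<le> (\<rho> *\<^sub>R t - axis i d) $ k" for k
          using r_le[of k] by (auto simp: axis_def d_def)
        note le = path_utility_mono[of r _ "\<rho> *\<^sub>R t - axis i d", OF this]
        have "path_utility r a T \<le> \<rho> * (?G T + C) - path_utility (axis i d) a T" for a
          using le[of a T] upper[OF T, of a] by (simp add: path_utility_diff)
        then have "?E (\<lambda>_. p) T \<le> (\<integral>a. \<rho> * (?G T + C) - path_utility (axis i d) a T
            \<partial>action_measure (\<lambda>_. p))"
          unfolding expected_utility_eq
          using integrable_path_utility by (intro integral_mono) auto
        also have "\<dots> = \<rho> * (?G T + C) - (\<integral>a. path_utility (axis i d) a T \<partial>action_measure (\<lambda>_. p))"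
          using integrable_path_utility by (simp add: prob_space)
        finally show ?thesis
          using expected_utility_single_action_ge[of d T p i, folded C'_def] d T by (simp add: \<delta>_def)
      qed
      \<comment> \<open>All constants left when the upper bound \<open>E_p\<close> is subtracted
        from the lower bound for always taking \<open>best\<close>.\<close>
      let ?K = "2 * \<rho> * C + \<delta> * C'"
      have "((\<lambda>T. \<delta> * c - ?K / ?g T) \<longlongrightarrow> \<delta> * c - 0) at_top"
        by (intro tendsto_diff tendsto_const tendsto_const_over_utility_growth)
      then have "ereal (\<delta> * c) = Limsup at_top (\<lambda>T. ereal (\<delta> * c - ?K / ?g T))"
        by (intro lim_imp_Limsup[symmetric] tendsto_ereal) simp_all
      also have "\<dots> \<le> Limsup at_top
          (\<lambda>T. ereal ((?E (\<lambda>_. return_pmf best) T - ?E (\<lambda>_. p) T) / ?g T))"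
      proof (intro Limsup_mono eventually_mono[OF ev])
        fix T assume T: "longest \<le> T \<and> 0 < ?g T"
        have "\<rho> * (?G T - C) \<le> ?E (\<lambda>_. return_pmf best) T"
          using T best by (intro E_lower) auto
        then have "\<delta> * ?G T - ?K \<le> ?E (\<lambda>_. return_pmf best) T - ?E (\<lambda>_. p) T"
          using E_p[of T] T by (simp add: algebra_simps)
        then have "(\<delta> * ?G T - ?K) / ?g T
            \<le> (?E (\<lambda>_. return_pmf best) T - ?E (\<lambda>_. p) T) / ?g T"
          using T by (intro divide_right_mono) auto
        moreover have "(\<delta> * ?G T - ?K) / ?g T = \<delta> * c - ?K / ?g T"
          using T by (simp add: c(2) diff_divide_distrib)
        ultimately show "ereal (\<delta> * c - ?K / ?g T)
            \<le> ereal ((?E (\<lambda>_. return_pmf best) T - ?E (\<lambda>_. p) T) / ?g T)"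
          by simp
      qed
      also have "\<dots> \<le> 0"
        using opt unfolding optimal_strategy_def by blast
      finally show False using \<delta> c(1) by (simp add: mult_le_0_iff)
    qed
  qed
qed

end

section \<open>Equilibria of the game\<close>

lemma stationary_equilibrium_iff:
  fixes r \<mu> :: "real ^ 'a::finite"
  assumes m: "0 < m" and \<alpha>: "0 \<le> \<alpha>" "\<alpha> \<le> 1" and r: "\<And>i. 0 < r $ i"
    and t: "\<And>i. 0 < \<tau> \<mu> $ i" and \<mu>: "\<mu> \<in> mass_simplex m"
  shows "stationary_equilibrium \<alpha> m r \<tau> \<mu> \<longleftrightarrow>
    (\<forall>i\<in>{i. \<mu> $ i > 0}. \<forall>j. r $ i / \<tau> \<mu> $ i \<ge> r $ j / \<tau> \<mu> $ j)"
proof -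
  interpret positive_sojourn_times \<alpha> "\<tau> \<mu>" by unfold_locales (use \<alpha> t in auto)
  have \<mu>_nonneg: "0 \<le> \<mu> $ i" for i using \<mu> by (simp add: mass_simplex_def)
  have \<mu>_sum: "(\<Sum>i\<in>UNIV. \<mu> $ i) = m" using \<mu> by (simp add: mass_simplex_def)
  have "\<exists>i. \<mu> $ i \<noteq> 0"
  proof (rule ccontr)
    assume "\<not> ?thesis"
    then show False using \<mu>_sum m by simp
  qed
  then obtain i0 where i0: "0 < \<mu> $ i0" using \<mu>_nonneg by (auto simp: less_le)
  \<comment> \<open>The sign of \<open>\<theta>\<close> is not prescribed; the positive mass at
    \<open>i0\<close> forces \<open>\<theta> > 0\<close>, so \<open>p\<close> and
    \<open>\<mu>\<close> have the same support.\<close>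
  have supp: "set_pmf p = {i. 0 < \<mu> $ i}"
    if p: "\<And>i. \<mu> $ i = \<theta> * pmf p i * \<tau> \<mu> $ i" for p \<theta>
  proof -
    have "0 < \<theta> * pmf p i0" using i0 p[of i0] t[of i0] by (simp add: zero_less_mult_iff)
    then have "0 < \<theta>" using pmf_nonneg[of p i0] by (simp add: zero_less_mult_iff)
    then have "0 < \<mu> $ i \<longleftrightarrow> 0 < pmf p i" for i
      using p[of i] t[of i] by (simp add: zero_less_mult_iff)
    then show ?thesis by (auto simp: pmf_positive_iff)
  qed
  \<comment> \<open>\<open>Z\<close> is the total action rate. The shares of the single rates give
    the required pmf, with \<open>Z\<close> as the normalizing constant.\<close>
  define Z where "Z = (\<Sum>i\<in>UNIV. \<mu> $ i / \<tau> \<mu> $ i)"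
  have "0 < Z" unfolding Z_def
    using \<mu>_nonneg t i0 by (intro sum_pos2[of _ i0]) (auto intro: divide_nonneg_pos)
  have "\<exists>p. \<forall>i. pmf p i = \<mu> $ i / \<tau> \<mu> $ i / Z"
  proof -
    have nonneg: "0 \<le> \<mu> $ i / \<tau> \<mu> $ i / Z" for i
      using \<mu>_nonneg t \<open>0 < Z\<close> by (simp add: less_imp_le)
    have "(\<Sum>i\<in>UNIV. \<mu> $ i / \<tau> \<mu> $ i / Z) = 1"
      using \<open>0 < Z\<close> unfolding sum_divide_distrib[symmetric] Z_def[symmetric] by simp
    then have "(\<integral>\<^sup>+i. ennreal (\<mu> $ i / \<tau> \<mu> $ i / Z) \<partial>count_space UNIV) = 1"
      using nonneg by (simp add: nn_integral_count_space_finite sum_ennreal)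
    from pmf_embed_pmf[OF nonneg this] show ?thesis by blast
  qed
  then obtain p where "\<And>i. pmf p i = \<mu> $ i / \<tau> \<mu> $ i / Z" by blast
  then have "\<And>i. \<mu> $ i = Z * pmf p i * \<tau> \<mu> $ i"
    using t \<open>0 < Z\<close> by (auto simp: less_le)
  then show ?thesis
    unfolding stationary_equilibrium_def using \<mu> supp optimal_stationary_iff[OF r] by blast
qed

theorem theorem2:
  fixes m \<alpha> :: real
    and r :: "real ^ 'a::finite"
    and \<tau> :: "real ^ 'a \<Rightarrow> real ^ 'a"
  assumes "CARD('a) \<ge> 2"
    and "m > 0"
    and "\<And>i. r $ i > 0"
    and "0 \<le> \<alpha>" "\<alpha> \<le> 1"
    and "\<And>\<mu> i. \<mu> \<in> mass_distributions \<Longrightarrow> \<tau> \<mu> $ i > 0"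
    and "\<And>s. s > 0 \<Longrightarrow> continuous_on (mass_simplex s) \<tau>"
    and "rate_monotonous \<tau>"
  shows "(\<exists>\<mu>. stationary_equilibrium \<alpha> m r \<tau> \<mu>) \<and>
    (\<forall>\<mu>\<in>mass_simplex m. stationary_equilibrium \<alpha> m r \<tau> \<mu> \<longleftrightarrow>
      (\<forall>i\<in>{i. \<mu> $ i > 0}. \<forall>j. r $ i / \<tau> \<mu> $ i \<ge> r $ j / \<tau> \<mu> $ j))"
proof -
  have \<tau>_pos: "\<tau> \<mu> $ i > 0" if "\<mu> \<in> mass_simplex m" for \<mu> i
    using assms(2,6) that by (auto simp: mass_distributions_def)
  have iff: "stationary_equilibrium \<alpha> m r \<tau> \<mu> \<longleftrightarrow>
      (\<forall>i\<in>{i. \<mu> $ i > 0}. \<forall>j. r $ i / \<tau> \<mu> $ i \<ge> r $ j / \<tau> \<mu> $ j)" if "\<mu> \<in> mass_simplex m" for \<mu>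
    by (intro stationary_equilibrium_iff assms \<tau>_pos that)
  \<comment> \<open>The variational inequality is applied to the vector of reward rates.\<close>
  have "continuous_on (mass_simplex m) (\<lambda>\<mu>. \<chi> i. r $ i / \<tau> \<mu> $ i)"
    using assms(7)[OF assms(2)] \<tau>_pos by (intro continuous_intros) (auto simp: less_le)
  from ex_maximal_on_support[OF less_imp_le[OF assms(2)] this]
  obtain \<mu> where "\<mu> \<in> mass_simplex m"
    "\<forall>i j. 0 < \<mu> $ i \<longrightarrow> r $ j / \<tau> \<mu> $ j \<le> r $ i / \<tau> \<mu> $ i"
    by auto
  then have "stationary_equilibrium \<alpha> m r \<tau> \<mu>" by (simp add: iff)
  then show ?thesis using iff by blast
qed

end
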